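(* Let $m \geq 2$ be an integer and let $C_{2m}(x_1,\ldots,x_{2m}) := L_{2m+1}(x_1,\ldots,x_{2m},0)$, where $$L_{2m+1}(x_1,\ldots,x_{2m+1}) := m(m+1)\sum_{1\le i<j\le 2m+1}(x_i-x_j)^4 - \Big(\sum_{1\le i<j\le 2m+1}(x_i-x_j)^2\Big)^2 .$$ Then $C_{2m}(x_1,\ldots,x_{2m})$ is not sos.
   Context: A form is a homogeneous polynomial with real coefficients. A real form $f \in \mathbb{R}[x_1,\ldots,x_n]$ is called a sum of squares (sos) if there exist finitely many real forms $h_1,\ldots,h_k \in \mathbb{R}[x_1,\ldots,x_n]$ with $f = h_1^2+\cdots+h_k^2$. *)

theory Defs
  imports Complex_Main "HOL-Library.Poly_Mapping"
begin

(* Real polynomials in variables indexed by nat: a monomial is a finitely supported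
   exponent vector, a polynomial a finitely supported map from monomials to coefficients. *)
type_synonym real_mpoly = "(nat \<Rightarrow>\<^sub>0 nat) \<Rightarrow>\<^sub>0 real"

definition Var :: "nat \<Rightarrow> real_mpoly" where
  "Var i = Poly_Mapping.single (Poly_Mapping.single i 1) 1"

definition mon_degree :: "(nat \<Rightarrow>\<^sub>0 nat) \<Rightarrow> nat" where
  "mon_degree a = (\<Sum>i\<in>Poly_Mapping.keys a. Poly_Mapping.lookup a i)"

definition homogeneous :: "nat \<Rightarrow> real_mpoly \<Rightarrow> bool" where
  "homogeneous d p \<longleftrightarrow> (\<forall>a\<in>Poly_Mapping.keys p. mon_degree a = d)"

(* The polynomial ring in x_1, ..., x_n. *)
definition polys :: "nat \<Rightarrow> real_mpoly set" where
  "polys n = {p. \<forall>a\<in>Poly_Mapping.keys p. Poly_Mapping.keys a \<subseteq> {1..n}}"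

(* The zero polynomial is a form. *)
definition is_form :: "nat \<Rightarrow> real_mpoly \<Rightarrow> bool" where
  "is_form n p \<longleftrightarrow> p \<in> polys n \<and> (\<exists>d. homogeneous d p)"

(* That f itself is a form is deliberately not a conjunct, so that it cannot be the reason
   why sos fails; for the polynomial of interest it is lemma is_form_C below. *)
definition sos :: "nat \<Rightarrow> real_mpoly \<Rightarrow> bool" where
  "sos n f \<longleftrightarrow> (\<exists>hs. (\<forall>h\<in>set hs. is_form n h) \<and> f = (\<Sum>h\<leftarrow>hs. h\<^sup>2))"

(* The form L in 2m+1 variables, with polynomials x 1, ..., x (2m+1) substituted for them;
   the form itself is L_form m Var. *)
definition L_form :: "nat \<Rightarrow> (nat \<Rightarrow> real_mpoly) \<Rightarrow> real_mpoly" where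
  "L_form m x =
     of_nat (m * (m + 1)) * (\<Sum>i=1..2*m+1. \<Sum>j=i+1..2*m+1. (x i - x j)^4)
     - (\<Sum>i=1..2*m+1. \<Sum>j=i+1..2*m+1. (x i - x j)\<^sup>2)\<^sup>2"

definition C_form :: "nat \<Rightarrow> real_mpoly" where
  "C_form m = L_form m (Var(2*m+1 := 0))"

lemma mon_degree_superset:
  "finite A \<Longrightarrow> Poly_Mapping.keys a \<subseteq> A \<Longrightarrow> mon_degree a = (\<Sum>i\<in>A. Poly_Mapping.lookup a i)"
  unfolding mon_degree_def by (rule sum.mono_neutral_left) (auto simp: in_keys_iff)

lemma mon_degree_add: "mon_degree (a + b) = mon_degree a + mon_degree b"
proof -
  let ?A = "Poly_Mapping.keys a \<union> Poly_Mapping.keys b"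
  have "mon_degree (a + b) = (\<Sum>i\<in>?A. Poly_Mapping.lookup (a + b) i)"
    by (rule mon_degree_superset) (simp_all add: Poly_Mapping.keys_add)
  then show ?thesis
    by (simp add: lookup_add sum.distrib mon_degree_superset[of ?A])
qed

lemma keys_of_nat: "Poly_Mapping.keys (of_nat k :: real_mpoly) \<subseteq> {0}"
proof -
  have "(of_nat k :: real_mpoly) = Poly_Mapping.single 0 (of_nat k)"
    by (rule single_of_nat[symmetric])
  then show ?thesis by (simp only: Poly_Mapping.keys_single) auto
qed

lemma keys_mult_obtain:
  assumes "a \<in> Poly_Mapping.keys (p * q)"
  obtains b c where "a = b + c" "b \<in> Poly_Mapping.keys p" "c \<in> Poly_Mapping.keys q"
  using assms Poly_Mapping.keys_mult[of p q] by blast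

lemma homogeneous_0: "homogeneous d 0"
  by (simp add: homogeneous_def)

lemma homogeneous_diff: "homogeneous d p \<Longrightarrow> homogeneous d q \<Longrightarrow> homogeneous d (p - q)"
  unfolding homogeneous_def using Poly_Mapping.keys_diff[of p q] by blast

lemma homogeneous_mult: "homogeneous d p \<Longrightarrow> homogeneous e q \<Longrightarrow> homogeneous (d + e) (p * q)"
  unfolding homogeneous_def by (metis keys_mult_obtain mon_degree_add)

lemma homogeneous_sum: "(\<And>i. i \<in> I \<Longrightarrow> homogeneous d (r i)) \<Longrightarrow> homogeneous d (sum r I)"
  unfolding homogeneous_def using Poly_Mapping.keys_sum[of r I] by blast

lemma homogeneous_of_nat: "homogeneous 0 (of_nat k)"
  unfolding homogeneous_def mon_degree_def using keys_of_nat[of k] by fastforce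

lemma homogeneous_Var: "homogeneous 1 (Var i)"
  by (simp add: homogeneous_def Var_def mon_degree_def)

lemma polys_0: "0 \<in> polys n"
  by (simp add: polys_def)

lemma polys_diff: "p \<in> polys n \<Longrightarrow> q \<in> polys n \<Longrightarrow> p - q \<in> polys n"
  unfolding polys_def using Poly_Mapping.keys_diff[of p q] by blast

lemma polys_mult:
  assumes "p \<in> polys n" "q \<in> polys n"
  shows "p * q \<in> polys n"
proof -
  have "Poly_Mapping.keys a \<subseteq> {1..n}" if a: "a \<in> Poly_Mapping.keys (p * q)" for a
  proof -
    obtain b c where "a = b + c" "b \<in> Poly_Mapping.keys p" "c \<in> Poly_Mapping.keys q"
      using a by (rule keys_mult_obtain)
    then show ?thesis
      using assms Poly_Mapping.keys_add[of b c] unfolding polys_def by blast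
  qed
  then show ?thesis by (simp add: polys_def)
qed

lemma polys_sum: "(\<And>i. i \<in> I \<Longrightarrow> r i \<in> polys n) \<Longrightarrow> sum r I \<in> polys n"
  unfolding polys_def using Poly_Mapping.keys_sum[of r I] by blast

lemma polys_of_nat: "of_nat k \<in> polys n"
  unfolding polys_def using keys_of_nat[of k] by fastforce

lemma polys_Var: "1 \<le> i \<Longrightarrow> i \<le> n \<Longrightarrow> Var i \<in> polys n"
  by (simp add: polys_def Var_def)

lemma polys_power: "p \<in> polys n \<Longrightarrow> p ^ k \<in> polys n"
  using polys_of_nat[of 1 n] by (induction k) (simp_all add: polys_mult)

lemma homogeneous_C: "homogeneous 4 (C_form m)"
proof -
  have v: "homogeneous 1 ((Var(k := 0)) i)" for i k
    using homogeneous_0[of 1] homogeneous_Var[of i] by simp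
  have sq: "homogeneous (d + d) (p\<^sup>2)" if "homogeneous d p" for p d
    using homogeneous_mult[OF that that] by (simp only: power2_eq_square)
  have d2: "homogeneous 2 ((x i - x j)\<^sup>2)" if "\<And>i. homogeneous 1 (x i)" for x :: "nat \<Rightarrow> real_mpoly" and i j
    using sq[OF homogeneous_diff[OF that that], of i j] by (simp add: numeral_2_eq_2)
  have sq2: "homogeneous 4 (p\<^sup>2)" if "homogeneous 2 p" for p
    using sq[OF that] by simp
  have d4: "homogeneous 4 ((x i - x j)^4)" if "\<And>i. homogeneous 1 (x i)" for x :: "nat \<Rightarrow> real_mpoly" and i j
    using sq2[OF d2[of x i j, OF that]] by (simp flip: power_mult)
  have c: "homogeneous 4 (of_nat k * p)" if "homogeneous 4 p" for k p
    using homogeneous_mult[OF homogeneous_of_nat that] by simp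
  show ?thesis
    unfolding C_form_def L_form_def
    by (intro homogeneous_diff c sq2 homogeneous_sum d2 d4 v)
qed

lemma is_form_C: "is_form (2 * m) (C_form m)"
proof -
  have v: "(Var(2*m+1 := 0)) i \<in> polys (2 * m)" if "i \<in> {1..2*m+1}" for i
    using that polys_0 polys_Var[where i = i and n = "2 * m"] by (auto simp: le_Suc_eq)
  have "C_form m \<in> polys (2 * m)"
    unfolding C_form_def L_form_def
    by (intro polys_diff polys_mult polys_sum polys_of_nat polys_power v) auto
  then show ?thesis
    using homogeneous_C unfolding is_form_def by blast
qed

end

theory Submission
  imports Defs "HOL-Library.Indicator_Function"
begin

text \<open>
  The form \<open>C\<close> has too many real zeros to be a sum of squares. At a 0/1 vector with \<open>k\<close> ones all
  differences lie in \<open>{-1, 0, 1}\<close>, so both sums over pairs count the \<open>P = k (2 m + 1 - k)\<close> pairs of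
  distinct entries (the variable set to 0 is one of the entries), and \<open>C\<close> takes the value
  \<open>P (m (m + 1) - P)\<close> (\<open>eval_C_form_indicator\<close>). This vanishes for \<open>k = m\<close> and \<open>k = m + 1\<close>, but at a
  unit vector it is \<open>2 m\<^sup>2 (m - 1) > 0\<close>.

  Suppose that \<open>C\<close> is a sum of squares of forms \<open>h\<close>. Comparing growth along a ray shows that every
  \<open>h\<close> with a nonzero value has degree 2 (\<open>summand_degree\<close>). Each \<open>h\<close> vanishes wherever \<open>C\<close> does,
  in particular at the 0/1 vectors with \<open>m\<close> or \<open>m + 1\<close> ones. For a quadratic form in \<open>2 m\<close>
  variables this forces it to vanish at all 0/1 vectors (\<open>quadratic_form_vanishes\<close>): regarded as a
  function of the set \<open>S\<close> of ones, it is a sum of weights over the subsets of \<open>S\<close> of size 1 and 2.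
  Adding an element to a set of size \<open>m\<close> changes nothing, and comparing two such sets that differ
  by a swap shows that all pairs have the same weight; then all weights are 0.
  Hence \<open>C\<close> would be zero at the unit vectors, a contradiction.
\<close>

section \<open>Evaluating polynomials\<close>

definition mon_eval :: "(nat \<Rightarrow> real) \<Rightarrow> (nat \<Rightarrow>\<^sub>0 nat) \<Rightarrow> real" where
  "mon_eval v a = (\<Prod>i\<in>Poly_Mapping.keys a. v i ^ Poly_Mapping.lookup a i)"

definition eval :: "(nat \<Rightarrow> real) \<Rightarrow> real_mpoly \<Rightarrow> real" where
  "eval v p = (\<Sum>a\<in>Poly_Mapping.keys p. Poly_Mapping.lookup p a * mon_eval v a)"

lemma mon_eval_superset:
  "finite A \<Longrightarrow> Poly_Mapping.keys a \<subseteq> A \<Longrightarrow> mon_eval v a = (\<Prod>i\<in>A. v i ^ Poly_Mapping.lookup a i)"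
  unfolding mon_eval_def by (rule prod.mono_neutral_left) (auto simp: in_keys_iff)

lemma mon_eval_add: "mon_eval v (a + b) = mon_eval v a * mon_eval v b"
proof -
  let ?A = "Poly_Mapping.keys a \<union> Poly_Mapping.keys b"
  have "mon_eval v (a + b) = (\<Prod>i\<in>?A. v i ^ Poly_Mapping.lookup (a + b) i)"
    by (rule mon_eval_superset) (simp_all add: Poly_Mapping.keys_add)
  then show ?thesis
    by (simp add: lookup_add power_add prod.distrib mon_eval_superset[of ?A])
qed

lemma eval_superset:
  "finite A \<Longrightarrow> Poly_Mapping.keys p \<subseteq> A \<Longrightarrow> eval v p = (\<Sum>a\<in>A. Poly_Mapping.lookup p a * mon_eval v a)"
  unfolding eval_def by (rule sum.mono_neutral_left) (auto simp: in_keys_iff)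

lemma eval_single: "eval v (Poly_Mapping.single a c) = c * mon_eval v a"
  by (simp add: eval_superset[of "{a}"])

lemma eval_0 [simp]: "eval v 0 = 0"
  by (simp add: eval_def)

lemma eval_add: "eval v (p + q) = eval v p + eval v q"
proof -
  let ?A = "Poly_Mapping.keys p \<union> Poly_Mapping.keys q"
  have "eval v (p + q) = (\<Sum>a\<in>?A. Poly_Mapping.lookup (p + q) a * mon_eval v a)"
    by (rule eval_superset) (simp_all add: Poly_Mapping.keys_add)
  then show ?thesis
    by (simp add: lookup_add distrib_right sum.distrib eval_superset[of ?A])
qed

lemma eval_diff: "eval v (p - q) = eval v p - eval v q"
  using eval_add[of v "p - q" q] by simp

lemma eval_sum: "eval v (sum r I) = (\<Sum>i\<in>I. eval v (r i))"
  by (induction I rule: infinite_finite_induct) (simp_all add: eval_add)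

lemma sum_of_monomials: "p = (\<Sum>a\<in>Poly_Mapping.keys p. Poly_Mapping.single a (Poly_Mapping.lookup p a))"
  for p :: real_mpoly
  by (rule poly_mapping_eqI) (simp add: lookup_sum lookup_single when_def in_keys_iff)

lemma eval_mult: "eval v (p * q) = eval v p * eval v q"
proof -
  have "p * q = (\<Sum>a\<in>Poly_Mapping.keys p. \<Sum>b\<in>Poly_Mapping.keys q.
      Poly_Mapping.single (a + b) (Poly_Mapping.lookup p a * Poly_Mapping.lookup q b))"
    by (subst (1) sum_of_monomials[of p], subst (1) sum_of_monomials[of q])
       (simp only: sum_product mult_single)
  then have "eval v (p * q) = (\<Sum>a\<in>Poly_Mapping.keys p. \<Sum>b\<in>Poly_Mapping.keys q.
      (Poly_Mapping.lookup p a * mon_eval v a) * (Poly_Mapping.lookup q b * mon_eval v b))"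
    by (simp add: eval_sum eval_single mon_eval_add mult_ac)
  then show ?thesis
    by (simp add: eval_def sum_product)
qed

lemma eval_of_nat: "eval v (of_nat k) = of_nat k"
  using eval_single[of v 0 "of_nat k"] by (simp add: mon_eval_def)

lemma eval_power: "eval v (p ^ k) = eval v p ^ k"
  using eval_of_nat[of v 1] by (induction k) (simp_all add: eval_mult)

lemma eval_Var: "eval v (Var i) = v i"
  by (simp add: Var_def eval_single mon_eval_def)

lemma eval_sum_list: "eval v (\<Sum>x\<leftarrow>xs. g x) = (\<Sum>x\<leftarrow>xs. eval v (g x))"
  by (induction xs) (simp_all add: eval_add)

lemma eval_homogeneous_scale:
  assumes "homogeneous d p"
  shows "eval (\<lambda>i. t * v i) p = t ^ d * eval v p"
proof -
  have "mon_eval (\<lambda>i. t * v i) a = t ^ d * mon_eval v a" if "a \<in> Poly_Mapping.keys p" for a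
    using assms that
    by (auto simp: mon_eval_def homogeneous_def mon_degree_def power_mult_distrib prod.distrib
        simp flip: power_sum)
  then show ?thesis
    by (simp add: eval_def sum_distrib_left mult_ac)
qed


section \<open>Degrees of the summands\<close>

text \<open>Large \<open>t\<close> exclude \<open>p > q\<close> and small \<open>t\<close> exclude \<open>p < q\<close>.\<close>

lemma power_le_power_scaled_imp_eq:
  fixes G :: real
  assumes le: "\<And>t. t > 0 \<Longrightarrow> t ^ p \<le> t ^ q * G"
  shows "p = q"
proof (rule ccontr)
  assume "p \<noteq> q"
  have G: "G \<ge> 1" using le[of 1] by simp
  consider "q < p" | "p < q" using \<open>p \<noteq> q\<close> by linarith
  then show False
  proof cases
    case 1
    define t where "t = G + 1"
    have t: "t > 1" using G by (simp add: t_def)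
    have "t ^ Suc q \<le> t ^ p" using 1 t by (intro power_increasing) auto
    also have "\<dots> \<le> t ^ q * G" using le t by simp
    finally have "t \<le> G" using t by (simp add: mult.commute)
    then show False by (simp add: t_def)
  next
    case 2
    define t where "t = 1 / (G + 1)"
    have t: "0 < t" "t < 1" using G by (simp_all add: t_def)
    have "t ^ p \<le> t ^ q * G" using le t by simp
    also have "\<dots> \<le> t ^ Suc p * G"
      using 2 t G by (intro mult_right_mono power_decreasing) auto
    finally have "1 \<le> t * G" using t by (simp add: mult.assoc mult.left_commute)
    then show False using G by (simp add: t_def field_simps)
  qed
qed

lemma square_le_sum_squares:
  assumes "h \<in> set hs"
  shows "(eval v h)\<^sup>2 \<le> eval v (\<Sum>g\<leftarrow>hs. g\<^sup>2)"
proof -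
  have "(eval v h)\<^sup>2 \<le> (\<Sum>g\<leftarrow>hs. (eval v g)\<^sup>2)"
    by (rule member_le_sum_list) (use assms in auto)
  then show ?thesis by (simp add: eval_sum_list eval_power)
qed

text \<open>
  The summands may be forms of different degrees. At the point \<open>t v\<close> the square of \<open>h\<close> scales with
  \<open>t ^ (2 * e)\<close> and is bounded by the whole sum, which scales with \<open>t ^ (2 * d)\<close>.
\<close>

lemma summand_degree:
  assumes f: "homogeneous (2 * d) (\<Sum>g\<leftarrow>hs. g\<^sup>2)" and h: "h \<in> set hs" "homogeneous e h"
    and nz: "eval v h \<noteq> 0"
  shows "e = d"
proof -
  let ?F = "eval v (\<Sum>g\<leftarrow>hs. g\<^sup>2)"
  have "t ^ (2 * e) \<le> t ^ (2 * d) * (?F / (eval v h)\<^sup>2)" for t :: real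
  proof -
    have "(t ^ e * eval v h)\<^sup>2 \<le> t ^ (2 * d) * ?F"
      using square_le_sum_squares[OF h(1), of "\<lambda>i. t * v i"]
      by (simp only: eval_homogeneous_scale[OF f] eval_homogeneous_scale[OF h(2)])
    then have "t ^ (2 * e) * (eval v h)\<^sup>2 \<le> t ^ (2 * d) * ?F"
      by (simp add: power_mult_distrib mult.commute flip: power_mult)
    then show ?thesis using nz by (simp add: field_simps)
  qed
  then have "2 * e = 2 * d" by (rule power_le_power_scaled_imp_eq)
  then show ?thesis by simp
qed


section \<open>Quadratic forms on 0/1 vectors\<close>

text \<open>
  At the indicator of \<open>S\<close> a monomial is 1 if all its variables lie in \<open>S\<close> and 0 otherwise. Grouping
  the monomials by their set of variables \<open>A\<close> makes the value a sum of weights over \<open>A \<subseteq> S\<close>, in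
  which \<open>x\<^sub>i\<close> and its powers are no longer distinguished.
\<close>

lemma eval_indicator:
  assumes S: "finite S"
  shows "eval (indicator S) p =
    (\<Sum>A\<in>Pow S. \<Sum>a | a \<in> Poly_Mapping.keys p \<and> Poly_Mapping.keys a = A. Poly_Mapping.lookup p a)"
proof -
  have mon: "mon_eval (indicator S) a = (if Poly_Mapping.keys a \<subseteq> S then 1 else 0)" for a
  proof (cases "Poly_Mapping.keys a \<subseteq> S")
    case True
    then show ?thesis by (auto simp: mon_eval_def indicator_def intro!: prod.neutral)
  next
    case False
    then obtain i where "i \<in> Poly_Mapping.keys a" "i \<notin> S" by blast
    then have "mon_eval (indicator S) a = 0"
      by (auto simp: mon_eval_def in_keys_iff intro!: prod_zero bexI[of _ i])
    then show ?thesis using False by simp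
  qed
  let ?K = "{a \<in> Poly_Mapping.keys p. Poly_Mapping.keys a \<subseteq> S}"
  have "eval (indicator S) p = (\<Sum>a\<in>?K. Poly_Mapping.lookup p a)"
    by (simp add: eval_def mon sum.inter_filter if_distrib[of "\<lambda>x. _ * x"] cong: if_cong)
  also have "\<dots> = (\<Sum>A\<in>Pow S. \<Sum>a | a \<in> ?K \<and> Poly_Mapping.keys a = A. Poly_Mapping.lookup p a)"
    by (rule sum.group[symmetric]) (use S in auto)
  also have "\<dots> = (\<Sum>A\<in>Pow S. \<Sum>a | a \<in> Poly_Mapping.keys p \<and> Poly_Mapping.keys a = A. Poly_Mapping.lookup p a)"
    by (intro sum.cong refl) auto
  finally show ?thesis .
qed

lemma card_keys_le_mon_degree: "card (Poly_Mapping.keys a) \<le> mon_degree a"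
proof -
  have "(\<Sum>i\<in>Poly_Mapping.keys a. 1) \<le> (\<Sum>i\<in>Poly_Mapping.keys a. Poly_Mapping.lookup a i)"
    by (rule sum_mono) (simp add: in_keys_iff Suc_le_eq)
  then show ?thesis by (simp add: mon_degree_def)
qed

text \<open>
  The new subsets are \<open>insert j A\<close> with \<open>A \<subseteq> S\<close>, and of these only the ones with \<open>A\<close> empty or a
  singleton carry weight.
\<close>

lemma quadratic_set_function_insert:
  fixes b :: "'a set \<Rightarrow> real"
  assumes b: "\<And>A. card A > 2 \<Longrightarrow> b A = 0" and S: "finite S" "j \<notin> S"
  shows "(\<Sum>A\<in>Pow (insert j S). b A) = (\<Sum>A\<in>Pow S. b A) + b {j} + (\<Sum>t\<in>S. b {j, t})"
proof -
  have inj: "inj_on (insert j) (Pow S)" using S(2) by (auto simp: inj_on_def)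
  have "(\<Sum>A\<in>Pow (insert j S). b A) = (\<Sum>A\<in>Pow S. b A) + (\<Sum>A\<in>insert j ` Pow S. b A)"
    unfolding Pow_insert by (rule sum.union_disjoint) (use S in auto)
  also have "(\<Sum>A\<in>insert j ` Pow S. b A) = (\<Sum>A\<in>Pow S. b (insert j A))"
    by (simp add: sum.reindex[OF inj])
  also have "\<dots> = (\<Sum>A\<in>insert {} ((\<lambda>t. {t}) ` S). b (insert j A))"
  proof (rule sum.mono_neutral_right)
    show "\<forall>A\<in>Pow S - insert {} ((\<lambda>t. {t}) ` S). b (insert j A) = 0"
    proof
      fix A assume A: "A \<in> Pow S - insert {} ((\<lambda>t. {t}) ` S)"
      then have fin: "finite A" and "j \<notin> A" using S by (auto intro: finite_subset)
      have "card A \<noteq> 0" "card A \<noteq> 1" using A fin by (auto simp: card_1_singleton_iff)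
      then have "card A \<ge> 2" by linarith
      then show "b (insert j A) = 0" using fin \<open>j \<notin> A\<close> by (intro b) simp
    qed
  qed (use S in auto)
  also have "\<dots> = b {j} + (\<Sum>t\<in>S. b {j, t})"
    using S(1) by (subst sum.insert) (auto simp: sum.reindex inj_on_def)
  finally show ?thesis by simp
qed

text \<open>
  The unknowns are the weights of points and of pairs.
  Going from a set \<open>U\<close> of size \<open>m\<close> to \<open>insert j U\<close> relates the weight of \<open>j\<close> to those of the pairs
  \<open>{j, t}\<close> with \<open>t \<in> U\<close>. Exchanging one element of \<open>U\<close> shows that the latter do not depend on \<open>t\<close>;
  there is room for this since \<open>m \<ge> 2\<close> leaves at least \<open>m - 1\<close> elements outside any three.
  So all pairs have one weight \<open>\<beta>\<close>, all points have weight \<open>- m \<beta>\<close>, and a set of size \<open>m\<close> has the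
  value \<open>- \<beta> m (m + 1) / 2\<close>, whence \<open>\<beta> = 0\<close>.
\<close>

lemma quadratic_set_function_vanishes:
  fixes b :: "'a set \<Rightarrow> real"
  assumes N: "finite N" "card N = 2 * m" and m: "m \<ge> 2"
    and b0: "b {} = 0" and b: "\<And>A. card A > 2 \<Longrightarrow> b A = 0"
    and van: "\<And>S. S \<subseteq> N \<Longrightarrow> card S = m \<or> card S = m + 1 \<Longrightarrow> (\<Sum>A\<in>Pow S. b A) = 0"
    and S: "S \<subseteq> N"
  shows "(\<Sum>A\<in>Pow S. b A) = 0"
proof -
  have ins: "(\<Sum>A\<in>Pow (insert j U). b A) = (\<Sum>A\<in>Pow U. b A) + b {j} + (\<Sum>t\<in>U. b {j, t})"
    if "finite U" "j \<notin> U" for j U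
    by (rule quadratic_set_function_insert[OF _ that]) (rule b)
  have lin: "b {j} + (\<Sum>t\<in>U. b {j, t}) = 0" if "j \<in> N" "U \<subseteq> N" "j \<notin> U" "card U = m" for j U
  proof -
    have "finite U" using that(2) N(1) by (rule finite_subset)
    then show ?thesis
      using ins[of U j] van[of U] van[of "insert j U"] that by simp
  qed
  have eq1: "b {j, s} = b {j, t}" if "j \<in> N" "s \<in> N" "t \<in> N" "j \<noteq> s" "j \<noteq> t" for j s t
  proof (cases "s = t")
    case False
    have "m - 1 \<le> card (N - {j, s, t})"
      using that False N m by (simp add: card_Diff_subset)
    then obtain W where W: "W \<subseteq> N - {j, s, t}" "card W = m - 1" "finite W"
      by (rule obtain_subset_with_card_n)
    have "b {j} + (b {j, r} + (\<Sum>t\<in>W. b {j, t})) = 0" if r: "r = s \<or> r = t" for r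
    proof -
      have "r \<notin> W" "j \<notin> insert r W" "insert r W \<subseteq> N" using W(1) r \<open>j \<noteq> s\<close> \<open>j \<noteq> t\<close> \<open>s \<in> N\<close> \<open>t \<in> N\<close> by auto
      moreover have "card (insert r W) = m" using W \<open>r \<notin> W\<close> m by simp
      ultimately show ?thesis using lin[of j "insert r W"] \<open>j \<in> N\<close> W(3) by simp
    qed
    from this[of s] this[of t] show ?thesis by simp
  qed simp
  \<comment> \<open>Two pairs are joined by way of the pair made of their first elements.\<close>
  have eq: "b {i, k} = b {i', k'}"
    if "i \<in> N" "k \<in> N" "i \<noteq> k" "i' \<in> N" "k' \<in> N" "i' \<noteq> k'" for i k i' k'
  proof (cases "i = i'")
    case True
    then show ?thesis using eq1[of i k k'] that by simp
  next
    case False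
    then have "b {i, k} = b {i, i'}" using eq1[of i k i'] that by simp
    also have "\<dots> = b {i', k'}" using eq1[of i' i k'] that False by (simp add: insert_commute)
    finally show ?thesis .
  qed
  have "2 \<le> card N" using N m by simp
  then obtain P where "P \<subseteq> N" "card P = 2" by (meson obtain_subset_with_card_n)
  then obtain x y where xy: "x \<in> N" "y \<in> N" "x \<noteq> y" by (auto simp: card_2_iff)
  define \<beta> where "\<beta> = b {x, y}"
  have pair: "b {i, k} = \<beta>" if "i \<in> N" "k \<in> N" "i \<noteq> k" for i k
    using eq[of i k x y] that xy by (simp add: \<beta>_def)
  have single: "b {j} = - (real m * \<beta>)" if j: "j \<in> N" for j
  proof -
    have "m \<le> card (N - {j})" using N m j by simp
    then obtain U where U: "U \<subseteq> N - {j}" "card U = m" by (meson obtain_subset_with_card_n)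
    have "(\<Sum>t\<in>U. b {j, t}) = (\<Sum>t\<in>U. \<beta>)"
      using U j by (intro sum.cong refl pair) auto
    then have "b {j} + real m * \<beta> = 0"
      using lin[of j U] U j by (auto simp: subset_iff)
    then show ?thesis by simp
  qed
  have val: "(\<Sum>A\<in>Pow T. b A) = \<beta> * (real (card T) * (real (card T) - 1) / 2 - real m * real (card T))"
    if "finite T" "T \<subseteq> N" for T
    using that
  proof (induction T rule: finite_induct)
    case empty
    then show ?case by (simp add: b0)
  next
    case (insert j T)
    have "(\<Sum>t\<in>T. b {j, t}) = (\<Sum>t\<in>T. \<beta>)"
      using insert by (intro sum.cong refl pair) auto
    then show ?case
      using insert ins[of T j]
      by (simp add: single field_simps)
  qed
  have "m \<le> card N" using N by simp
  then obtain T where T: "T \<subseteq> N" "card T = m" "finite T" by (rule obtain_subset_with_card_n)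
  have "\<beta> * (real m * (real m - 1) / 2 - real m * real m) = 0"
    using van[of T] val[of T] T by simp
  moreover have "real m * (real m - 1) / 2 - real m * real m = - (real m * (real m + 1) / 2)"
    by (simp add: field_simps)
  ultimately have "\<beta> = 0" using m by auto
  then show ?thesis using val[of S] S N(1) by (simp add: finite_subset)
qed

lemma quadratic_form_vanishes:
  assumes h: "homogeneous 2 h" and N: "finite N" "card N = 2 * m" and m: "m \<ge> 2"
    and van: "\<And>S. S \<subseteq> N \<Longrightarrow> card S = m \<or> card S = m + 1 \<Longrightarrow> eval (indicator S) h = 0"
    and S: "S \<subseteq> N"
  shows "eval (indicator S) h = 0"
proof -
  define b where "b A = (\<Sum>a | a \<in> Poly_Mapping.keys h \<and> Poly_Mapping.keys a = A. Poly_Mapping.lookup h a)" for A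
  have ev: "eval (indicator S) h = (\<Sum>A\<in>Pow S. b A)" if "S \<subseteq> N" for S
    unfolding b_def using that N(1) by (intro eval_indicator) (rule finite_subset)
  have deg: "mon_degree a = 2" if "a \<in> Poly_Mapping.keys h" for a
    using h that by (simp add: homogeneous_def)
  have "b {} = 0"
    unfolding b_def by (rule sum.neutral) (use deg in \<open>force simp: mon_degree_def\<close>)
  moreover have "b A = 0" if "card A > 2" for A
    unfolding b_def
  proof (rule sum.neutral, safe)
    fix a assume "a \<in> Poly_Mapping.keys h" "A = Poly_Mapping.keys a"
    then show "Poly_Mapping.lookup h a = 0"
      using that deg card_keys_le_mon_degree[of a] by simp
  qed
  ultimately have "(\<Sum>A\<in>Pow S. b A) = 0"
    by (intro quadratic_set_function_vanishes[OF N m _ _ _ S]) (use van ev in auto)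
  then show ?thesis using ev[OF S] by simp
qed


section \<open>The values of the form on 0/1 vectors\<close>

text \<open>Lagrange's identity for \<open>y\<close> and the all-ones vector.\<close>

lemma sum_pairs_square_diff:
  fixes y :: "nat \<Rightarrow> real"
  shows "(\<Sum>i=1..n. \<Sum>j=i+1..n. (y i - y j)\<^sup>2) = real n * (\<Sum>i=1..n. (y i)\<^sup>2) - (\<Sum>i=1..n. y i)\<^sup>2"
proof (induction n)
  case (Suc n)
  have "(\<Sum>i=1..Suc n. \<Sum>j=i+1..Suc n. (y i - y j)\<^sup>2) = (\<Sum>i=1..n. \<Sum>j=i+1..Suc n. (y i - y j)\<^sup>2)"
    by (subst sum.nat_ivl_Suc') simp_all
  also have "\<dots> = (\<Sum>i=1..n. (\<Sum>j=i+1..n. (y i - y j)\<^sup>2) + (y i - y (Suc n))\<^sup>2)"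
    by (rule sum.cong[OF refl]) simp
  also have "\<dots> = (\<Sum>i=1..n. \<Sum>j=i+1..n. (y i - y j)\<^sup>2) + (\<Sum>i=1..n. (y i - y (Suc n))\<^sup>2)"
    by (simp add: sum.distrib)
  also have "(\<Sum>i=1..n. (y i - y (Suc n))\<^sup>2)
      = (\<Sum>i=1..n. (y i)\<^sup>2) + real n * (y (Suc n))\<^sup>2 - 2 * y (Suc n) * (\<Sum>i=1..n. y i)"
    by (simp add: power2_diff sum.distrib sum_subtractf sum_distrib_left mult_ac)
  finally show ?case
    unfolding Suc.IH by (simp add: power2_eq_square algebra_simps)
qed simp

lemma eval_C_form_indicator:
  assumes S: "S \<subseteq> {1..2*m}"
  defines "P \<equiv> real (card S) * (2 * real m + 1 - real (card S))"
  shows "eval (indicator S) (C_form m) = P * (real m * (real m + 1) - P)"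
proof -
  let ?y = "indicator S :: nat \<Rightarrow> real" and ?n = "2 * m + 1"
  have y: "eval ?y ((Var(?n := 0)) i) = ?y i" for i
    using S by (auto simp: eval_Var indicator_def)
  \<comment> \<open>The differences are -1, 0 or 1, so both sums over pairs in the form are equal.\<close>
  have fourth: "(?y i - ?y j) ^ 4 = (?y i - ?y j)\<^sup>2" for i j
    by (simp add: indicator_def)
  have "(\<Sum>i=1..?n. ?y i) = (\<Sum>i\<in>S. ?y i)"
    by (rule sum.mono_neutral_right) (use S in auto)
  then have sum: "(\<Sum>i=1..?n. ?y i) = real (card S)"
    by simp
  have sq: "(?y i)\<^sup>2 = ?y i" for i by (simp add: indicator_def)
  have P: "(\<Sum>i=1..?n. \<Sum>j=i+1..?n. (?y i - ?y j)\<^sup>2) = P"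
    unfolding sum_pairs_square_diff sq sum P_def by (simp add: power2_eq_square algebra_simps)
  have "eval ?y (C_form m) = real (m * (m + 1)) * (\<Sum>i=1..?n. \<Sum>j=i+1..?n. (?y i - ?y j) ^ 4)
      - (\<Sum>i=1..?n. \<Sum>j=i+1..?n. (?y i - ?y j)\<^sup>2)\<^sup>2"
    unfolding C_form_def L_form_def
    by (simp only: eval_diff eval_mult eval_of_nat eval_sum eval_power y)
  also have "\<dots> = real (m * (m + 1)) * P - P\<^sup>2"
    by (simp only: fourth P)
  finally show ?thesis by (simp add: power2_eq_square algebra_simps)
qed

theorem theorem2p9:
  fixes m :: nat
  assumes "m \<ge> 2"
  shows "\<not> sos (2 * m) (C_form m)"
proof
  assume "sos (2 * m) (C_form m)"
  then obtain hs where forms: "\<And>h. h \<in> set hs \<Longrightarrow> is_form (2 * m) h"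
    and C: "C_form m = (\<Sum>h\<leftarrow>hs. h\<^sup>2)"
    unfolding sos_def by blast
  have hom: "homogeneous (2 * 2) (\<Sum>h\<leftarrow>hs. h\<^sup>2)"
    using homogeneous_C[of m] by (simp add: C)
  \<comment> \<open>Variable 1 is an arbitrary choice: the value of the form is positive at every unit vector.\<close>
  have zero: "eval (indicator {1}) h = 0" if h: "h \<in> set hs" for h
  proof (rule ccontr)
    assume nz: "eval (indicator {1}) h \<noteq> 0"
    obtain d where d: "homogeneous d h" using forms[OF h] by (auto simp: is_form_def)
    have h2: "homogeneous 2 h" using d summand_degree[OF hom h d nz] by simp
    have van: "eval (indicator S) h = 0"
      if "S \<subseteq> {1..2*m}" "card S = m \<or> card S = m + 1" for S
    proof -
      have "eval (indicator S) (C_form m) = 0"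
        using that by (auto simp: eval_C_form_indicator)
      then have "(eval (indicator S) h)\<^sup>2 \<le> 0"
        using square_le_sum_squares[OF h, of "indicator S"] by (simp add: C)
      then show ?thesis by simp
    qed
    have "eval (indicator {1}) h = 0"
      by (rule quadratic_form_vanishes[OF h2 _ _ assms van, of "{1..2*m}"]) (use assms in auto)
    then show False using nz by simp
  qed
  have "eval (indicator {1}) (C_form m) = (\<Sum>h\<leftarrow>hs. 0)"
    unfolding C eval_sum_list eval_power
    by (intro arg_cong[where f = sum_list] map_cong refl) (use zero in simp)
  then have "2 * real m * (real m * (real m + 1) - 2 * real m) = 0"
    using assms by (simp add: eval_C_form_indicator)
  then show False using assms by simp
qed

end
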